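(* Let $G=(V,E)$ be a directed graph with $V=\{1,\dots,N\}$ and $E\subseteq V^2$ (self-loops allowed), with labeled adjacency matrix $\mathsf W$. Let $\mathcal C$ be the set of all non-empty subsets $C\subseteq V$ such that the subgraph of $G$ induced by $C$ is weakly connected, and for $C\in\mathcal C$ let $N(C)$ be the weak neighborhood of $C$ in $G$. Let $\mathsf P_{\mathrm{op}}(z)$ and $\mathsf P_{\mathrm{cl}}(z)$ be the matrix generating series of the open simple paths and of the closed simple paths (simple cycles) of $G$, respectively. Then: (i) $$\mathsf P_{\mathrm{op}}(z)=\sum_{C\in\mathcal C}(z\mathsf W_C)^{|C|-1}(\mathsf I-z\mathsf W_C)^{|N(C)|};$$ (ii) $$\mathsf P_{\mathrm{cl}}(z)=\sum_{C\in\mathcal C}\operatorname{Diag}\Big((z\mathsf W_C)^{|C|}(\mathsf I-z\mathsf W_C)^{|N(C)|}\Big).$$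
   Context: Each arc $(i,j)\in E$ carries a label $\omega_{ij}$. The labeled adjacency matrix $\mathsf W$ is the $N\times N$ matrix with $\mathsf W_{ij}=\omega_{ij}$ if $(i,j)\in E$ and $\mathsf W_{ij}=0$ otherwise. $\mathsf I$ is the $N\times N$ identity matrix and $z$ is a formal variable. A path $p$ of length $\ell(p)=\ell\ge 1$ from $i$ to $j$ is a sequence of $\ell$ contiguous arcs (each new arc starts where the previous one ended), written $p=\omega_{ii_1}\omega_{i_1i_2}\cdots\omega_{i_{\ell-1}j}$. A path is open if its end vertices $i,j$ are different and closed (a cycle) otherwise. By convention, the empty path $1$ is considered a cycle of zero length. $V(p)$ is the set of vertices of $p$ and $|V(p)|$ its size. Simple paths are paths that do not visit the same vertex more than once (the start and end vertices of a closed path coinciding); they are characterized as the non-empty paths $p$ such that $\ell(p)=|V(p)|-1$ if $p$ is open and $\ell(p)=|V(p)|$ if $p$ is closed. In particular self-loops $\omega_{ii}$ and backtracks $\omega_{ij}\omega_{ji}$ are cycles of length $1$ and $2$. $\mathsf P(z)$ is the $N\times N$ matrix with entries $\mathsf P_{ij}(z)=\sum_{p:\,i\to j,\ p\text{ simple}}p\,z^{\ell(p)}$. For a square matrix $\mathsf M$, $\operatorname{Diag}(\mathsf M)$ is the diagonal matrix obtained by setting all off-diagonal entries of $\mathsf M$ to zero. Set $\mathsf P_{\mathrm{cl}}(z)=\operatorname{Diag}(\mathsf P(z))$ and $\mathsf P_{\mathrm{op}}(z)=\mathsf P(z)-\mathsf P_{\mathrm{cl}}(z)$. For an $N\times N$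 matrix $\mathsf M$ and a non-empty $S\subseteq V$, $\mathsf M_S$ is the $N\times N$ matrix with $(\mathsf M_S)_{ij}=\mathsf M_{ij}$ if $i,j\in S$ and $0$ otherwise. A digraph is weakly connected if replacing all its directed edges by undirected edges produces a connected undirected graph. The weak neighborhood of $C$ is $N(C)=\{i\in V\setminus C:\ \exists j\in C,\ (i,j)\in E\text{ and/or }(j,i)\in E\}$.
   Formalization: In (i) the term N·I is subtracted from the right-hand side: each of the N singletons C contributes (zW_C)^0 = I, while P_op has zero diagonal, so (i) as printed fails (N=1, E empty gives 0 = I). All other coefficients, and (ii), are as printed. *)

theory Defs
  imports
    "HOL-Analysis.Analysis"
    "HOL-Computational_Algebra.Formal_Power_Series"
    "Graph_Theory.Digraph_Component"
begin

text \<open>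
  The vertex set \<open>V = {1, \<dots>, N}\<close> is the universe of a finite index type \<open>'n\<close>, so \<open>N = CARD('n)\<close>.
  Labels live in an arbitrary ring with 1, not assumed commutative: the product of the labels along
  a path keeps the order of its arcs, and the free ring on the arcs, where different paths have
  different products, is one instance. Power series over such a ring have a central variable
  \<open>fps_X\<close>, which plays the role of \<open>z\<close>.
\<close>

definition labeled_adjacency ::
  "'n::finite pair_pre_digraph \<Rightarrow> ('n \<times> 'n \<Rightarrow> 'a::zero) \<Rightarrow> 'a^'n^'n" where
  "labeled_adjacency G \<omega> = (\<chi> i j. if (i, j) \<in> parcs G then \<omega> (i, j) else 0)"

definition restrict_mat :: "'a::zero^'n^'n \<Rightarrow> 'n set \<Rightarrow> 'a^'n^'n" where
  "restrict_mat M S = (\<chi> i j. if i \<in> S \<and> j \<in> S then M $ i $ j else 0)"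

definition z_times :: "'a::ring_1^'n^'n \<Rightarrow> 'a fps^'n^'n" where
  "z_times M = (\<chi> i j. fps_X * fps_const (M $ i $ j))"

definition zW :: "'n::finite pair_pre_digraph \<Rightarrow> ('n \<times> 'n \<Rightarrow> 'a::ring_1) \<Rightarrow> 'n set \<Rightarrow> 'a fps^'n^'n" where
  "zW G \<omega> C = z_times (restrict_mat (labeled_adjacency G \<omega>) C)"

definition Diag :: "'a::zero^'n^'n \<Rightarrow> 'a^'n^'n" where
  "Diag M = (\<chi> i j. if i = j then M $ i $ j else 0)"

text \<open>The library operation \<open>(^)\<close> on \<open>vec\<close> is taken componentwise; this is the power
  for the matrix product.\<close>

primrec mat_power :: "'a::semiring_1^'n::finite^'n \<Rightarrow> nat \<Rightarrow> 'a^'n^'n" where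
  "mat_power M 0 = mat 1"
| "mat_power M (Suc k) = M ** mat_power M k"

text \<open>A path is the list of its arcs. A simple closed path has a first vertex, so a simple cycle
  with \<open>\<ell>\<close> vertices occurs once for each of its \<open>\<ell>\<close> vertices.\<close>

definition simple_paths :: "'n pair_pre_digraph \<Rightarrow> 'n \<Rightarrow> 'n \<Rightarrow> ('n \<times> 'n) list set" where
  "simple_paths G i j =
    {p. p \<noteq> [] \<and> pre_digraph.awalk (with_proj G) i p j \<and>
        (let V = set (pre_digraph.awalk_verts (with_proj G) i p)
         in if i = j then length p = card V else length p = card V - 1)}"

lemma finite_simple_paths: "finite (simple_paths (G :: 'n::finite pair_pre_digraph) i j)"
proof (rule finite_subset)
  have "length p \<le> CARD('n)" if "p \<in> simple_paths G i j" for p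
    using that card_mono[OF finite subset_UNIV,
      of "set (pre_digraph.awalk_verts (with_proj G) i p)"]
    by (auto simp: simple_paths_def Let_def split: if_splits)
  then show "simple_paths G i j \<subseteq> {p. set p \<subseteq> UNIV \<and> length p \<le> CARD('n)}"
    by auto
qed (rule finite_lists_length_le, simp)

definition P_mat :: "'n::finite pair_pre_digraph \<Rightarrow> ('n \<times> 'n \<Rightarrow> 'a::ring_1) \<Rightarrow> 'a fps^'n^'n" where
  "P_mat G \<omega> = (\<chi> i j. \<Sum>p\<in>simple_paths G i j. fps_const (prod_list (map \<omega> p)) * fps_X ^ length p)"

definition P_cl :: "'n::finite pair_pre_digraph \<Rightarrow> ('n \<times> 'n \<Rightarrow> 'a::ring_1) \<Rightarrow> 'a fps^'n^'n" where
  "P_cl G \<omega> = Diag (P_mat G \<omega>)"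

definition P_op :: "'n::finite pair_pre_digraph \<Rightarrow> ('n \<times> 'n \<Rightarrow> 'a::ring_1) \<Rightarrow> 'a fps^'n^'n" where
  "P_op G \<omega> = P_mat G \<omega> - P_cl G \<omega>"

text \<open>\<open>Digraph_Component.connected\<close> is weak connectivity: strong connectivity of the symmetric
  closure. The plain name denotes the topological notion here.\<close>

definition connected_sets :: "'n pair_pre_digraph \<Rightarrow> 'n set set" where
  "connected_sets G =
    {C. C \<noteq> {} \<and> C \<subseteq> pverts G \<and> Digraph_Component.connected (with_proj G \<restriction> C)}"

definition weak_nbhd :: "'n pair_pre_digraph \<Rightarrow> 'n set \<Rightarrow> 'n set" where
  "weak_nbhd G C = {i \<in> pverts G - C. \<exists>j\<in>C. (i, j) \<in> parcs G \<or> (j, i) \<in> parcs G}"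

text \<open>
  For a singleton \<open>C\<close> the factor \<open>(z W\<^sub>C)\<^bsup>|C| - 1\<^esup>\<close> is the full identity matrix \<open>I\<close>. Each of the
  \<open>N\<close> singletons therefore puts a constant term \<open>I\<close>, a family of empty walks, into
  \<open>\<Sum>\<^sub>C (z W\<^sub>C)\<^bsup>|C| - 1\<^esup> (I - z W\<^sub>C)\<^bsup>|N(C)|\<^esup>\<close>, whereas \<open>P_op\<close> has zero diagonal. The identity for \<open>P_op\<close>
  is correct once these constant terms are removed, that is, with \<open>- N I\<close>; off the
  diagonal the correction is zero. Already for \<open>N = 1\<close> the uncorrected identity would
  read \<open>0 = I\<close>.
\<close>

end

theory Submission
  imports Defs
begin

text \<open>
  Let \<open>S\<close> be non-empty and weakly connected and let a random vertex set \<open>U\<close> contain \<open>S\<close> and, independently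
  with probability \<open>x\<close>, every other vertex. The weak component of \<open>U\<close> that contains \<open>S\<close> equals \<open>C\<close> iff
  \<open>C \<subseteq> U\<close> and \<open>U\<close> misses \<open>N(C)\<close>, so summing over the values of the component gives
  \<open>\<Sum>\<^sub>C x\<^bsup>|C|\<^esup> (1 - x)\<^bsup>|N(C)|\<^esup> = x\<^bsup>|S|\<^esup>\<close>, the sum being over the connected \<open>C \<supseteq> S\<close>.
  Expanding the matrix products into walks, a walk of length \<open>n \<ge> 1\<close> with vertex set \<open>S\<close> gets as its total
  coefficient that of \<open>x\<^bsup>n+1\<^esup>\<close> (for open paths) or \<open>x\<^bsup>n\<^esup>\<close> (for closed ones) in \<open>x\<^bsup>|S|\<^esup>\<close>, which is 1 for
  simple paths and 0 otherwise. A closed walk has \<open>|S| \<le> n\<close>, hence does not contribute to the first sum.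
\<close>

section \<open>Weakly connected vertex sets\<close>

definition weak_adj :: "'n pair_pre_digraph \<Rightarrow> 'n set \<Rightarrow> 'n rel" where
  "weak_adj G U = {(a, b). a \<in> U \<and> b \<in> U \<and> ((a, b) \<in> parcs G \<or> (b, a) \<in> parcs G)}"

lemma weak_adj_mono: "U \<subseteq> U' \<Longrightarrow> weak_adj G U \<subseteq> weak_adj G U'"
  by (auto simp: weak_adj_def)

lemma sym_rtrancl_weak_adj: "sym ((weak_adj G U)\<^sup>*)"
  by (rule sym_rtrancl) (auto simp: weak_adj_def sym_def)

text \<open>The two closures differ only in reflexive pairs outside \<open>U\<close>, so
  connectivity can be studied with the ordinary closure.\<close>

lemma rtrancl_on_weak_adj:
  "rtrancl_on U (weak_adj G U) = {(a, b). a \<in> U \<and> b \<in> U \<and> (a, b) \<in> (weak_adj G U)\<^sup>*}"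
proof (intro equalityI subrelI)
  fix a b assume "(a, b) \<in> rtrancl_on U (weak_adj G U)"
  then show "(a, b) \<in> {(a, b). a \<in> U \<and> b \<in> U \<and> (a, b) \<in> (weak_adj G U)\<^sup>*}"
    by induction auto
next
  fix a b assume "(a, b) \<in> {(a, b). a \<in> U \<and> b \<in> U \<and> (a, b) \<in> (weak_adj G U)\<^sup>*}"
  then have "(a, b) \<in> (weak_adj G U)\<^sup>*" "a \<in> U" "b \<in> U" by auto
  then show "(a, b) \<in> rtrancl_on U (weak_adj G U)"
    by induction (auto simp: weak_adj_def intro: rtrancl_on_into_rtrancl_on)
qed

lemma connected_sets_iff:
  "C \<in> connected_sets G \<longleftrightarrow>
     C \<noteq> {} \<and> C \<subseteq> pverts G \<and> (\<forall>a\<in>C. \<forall>b\<in>C. (a, b) \<in> (weak_adj G C)\<^sup>*)"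
proof -
  have "parcs (mk_symmetric (with_proj G \<restriction> C)) = weak_adj G C"
    by (fastforce simp: parcs_mk_symmetric weak_adj_def)
  then show ?thesis
    by (auto simp: connected_sets_def Digraph_Component.connected_def strongly_connected_def
        reachable_def rtrancl_on_weak_adj)
qed

text \<open>Since \<open>weak_adj\<close> is symmetric, any two vertices are joined through the root
  \<open>s\<close>.\<close>

lemma connected_setsI:
  assumes "s \<in> C" "C \<subseteq> pverts G" "\<And>a. a \<in> C \<Longrightarrow> (s, a) \<in> (weak_adj G C)\<^sup>*"
  shows "C \<in> connected_sets G"
  using assms symD[OF sym_rtrancl_weak_adj] unfolding connected_sets_iff
  by (meson empty_iff rtrancl_trans)

lemma singleton_connected: "v \<in> pverts G \<Longrightarrow> {v} \<in> connected_sets G"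
  by (rule connected_setsI) auto

definition weak_component :: "'n pair_pre_digraph \<Rightarrow> 'n \<Rightarrow> 'n set \<Rightarrow> 'n set" where
  "weak_component G s U = (weak_adj G U)\<^sup>* `` {s}"

lemma weak_component_subset: "s \<in> U \<Longrightarrow> weak_component G s U \<subseteq> U"
proof
  fix v assume "s \<in> U" "v \<in> weak_component G s U"
  then have "(s, v) \<in> (weak_adj G U)\<^sup>*" by (simp add: weak_component_def)
  then show "v \<in> U" using \<open>s \<in> U\<close> by induction (auto simp: weak_adj_def)
qed

lemma weak_component_connected:
  assumes "s \<in> U" "U \<subseteq> pverts G"
  shows "weak_component G s U \<in> connected_sets G"
proof (rule connected_setsI)
  let ?C = "weak_component G s U"
  show "s \<in> ?C" by (simp add: weak_component_def)
  show "?C \<subseteq> pverts G" using weak_component_subset[OF assms(1)] assms(2) by blast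
  fix a assume "a \<in> ?C"
  then have "(s, a) \<in> (weak_adj G U)\<^sup>*" by (simp add: weak_component_def)
  \<comment> \<open>Every vertex on a path from \<open>s\<close> is itself reachable from
    \<open>s\<close>, so the whole path stays inside the component.\<close>
  then show "(s, a) \<in> (weak_adj G ?C)\<^sup>*"
  proof induction
    case (step y z)
    then have "(s, z) \<in> (weak_adj G U)\<^sup>*" by simp
    with step have "(y, z) \<in> weak_adj G ?C"
      unfolding weak_component_def weak_adj_def by blast
    with step show ?case by simp
  qed simp
qed

lemma connected_subset_weak_component:
  assumes "S \<in> connected_sets G" "s \<in> S" "S \<subseteq> U"
  shows "S \<subseteq> weak_component G s U"
proof
  fix v assume "v \<in> S"
  with assms have "(s, v) \<in> (weak_adj G S)\<^sup>*" by (simp add: connected_sets_iff)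
  with rtrancl_mono[OF weak_adj_mono[OF assms(3)]] show "v \<in> weak_component G s U"
    by (auto simp: weak_component_def)
qed

text \<open>A neighbor of \<open>C\<close> lying in \<open>U\<close> would be absorbed into the
  component; conversely, a path that leaves \<open>C\<close> must step into
  \<open>weak_nbhd G C\<close>. The event is thus a condition on single vertices, and those outside
  \<open>C\<close> and its neighborhood stay free.\<close>

lemma weak_component_eq_iff:
  assumes "C \<in> connected_sets G" "s \<in> C" "s \<in> U" "U \<subseteq> pverts G"
  shows "weak_component G s U = C \<longleftrightarrow> C \<subseteq> U \<and> U \<inter> weak_nbhd G C = {}"
proof
  assume eq: "weak_component G s U = C"
  have "C \<subseteq> U" using weak_component_subset[OF assms(3)] eq by metis
  moreover have False if v: "v \<in> U" "v \<in> weak_nbhd G C" for v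
  proof -
    from v obtain j where "j \<in> C" "v \<notin> C" and j: "(v, j) \<in> parcs G \<or> (j, v) \<in> parcs G"
      by (auto simp: weak_nbhd_def)
    with \<open>C \<subseteq> U\<close> v have "(j, v) \<in> weak_adj G U" by (auto simp: weak_adj_def)
    moreover have "(s, j) \<in> (weak_adj G U)\<^sup>*"
      using \<open>j \<in> C\<close> eq by (auto simp: weak_component_def)
    ultimately have "v \<in> C" using eq by (auto simp: weak_component_def)
    with \<open>v \<notin> C\<close> show False ..
  qed
  ultimately show "C \<subseteq> U \<and> U \<inter> weak_nbhd G C = {}" by blast
next
  assume *: "C \<subseteq> U \<and> U \<inter> weak_nbhd G C = {}"
  have "v \<in> C" if "(s, v) \<in> (weak_adj G U)\<^sup>*" for v
    using that
  proof induction
    case (step y z)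
    then have "z \<in> U" "(y, z) \<in> parcs G \<or> (z, y) \<in> parcs G" by (auto simp: weak_adj_def)
    with * step.IH assms(4) show ?case unfolding weak_nbhd_def by blast
  qed (rule assms(2))
  then have "weak_component G s U \<subseteq> C" by (auto simp: weak_component_def)
  with connected_subset_weak_component[OF assms(1,2)] * show "weak_component G s U = C" by blast
qed

section \<open>The component identity\<close>

lemma sum_between_power_card:
  fixes x :: "'b::comm_ring_1"
  assumes "A \<inter> B = {}"
  shows "(\<Sum>U | A \<subseteq> U \<and> U \<inter> B = {}. x ^ card U * (1 - x) ^ card (- U)) =
    x ^ card A * (1 - x) ^ card (B :: 'n::finite set)"
proof -
  let ?R = "- (A \<union> B)"
  have "(\<Sum>U | A \<subseteq> U \<and> U \<inter> B = {}. x ^ card U * (1 - x) ^ card (- U)) =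
      (\<Sum>T\<in>Pow ?R. x ^ card (A \<union> T) * (1 - x) ^ card (- (A \<union> T)))"
    by (rule sum.reindex_bij_witness[where i = "\<lambda>T. A \<union> T" and j = "\<lambda>U. U - A"])
      (use assms in \<open>auto simp: Un_absorb1\<close>)
  also have "\<dots> = (\<Sum>T\<in>Pow ?R. (x ^ card A * (1 - x) ^ card B) * (x ^ card T * (1 - x) ^ card (?R - T)))"
  proof (rule sum.cong[OF refl])
    fix T assume "T \<in> Pow ?R"
    then have "card (A \<union> T) = card A + card T" "- (A \<union> T) = B \<union> (?R - T)"
      using assms by (auto intro: card_Un_disjoint)
    moreover have "card (B \<union> (?R - T)) = card B + card (?R - T)"
      by (rule card_Un_disjoint) auto
    ultimately show "x ^ card (A \<union> T) * (1 - x) ^ card (- (A \<union> T)) =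
        (x ^ card A * (1 - x) ^ card B) * (x ^ card T * (1 - x) ^ card (?R - T))"
      by (simp only: power_add ac_simps)
  qed
  \<comment> \<open>The sum over subsets of \<open>?R\<close> is the expanded product; each free
    vertex contributes the factor 1.\<close>
  also have "\<dots> = (x ^ card A * (1 - x) ^ card B) * (\<Prod>v\<in>?R. x + (1 - x))"
    by (subst prod_add) (simp_all add: sum_distrib_left)
  finally show ?thesis by simp
qed

text \<open>The probabilistic argument uses ring identities only, so \<open>x\<close> may later be a
  polynomial indeterminate.\<close>

lemma sum_connected_supersets:
  fixes x :: "'b::comm_ring_1" and G :: "'n::finite pair_pre_digraph"
  assumes "pverts G = UNIV" "S \<in> connected_sets G"
  shows "(\<Sum>C | C \<in> connected_sets G \<and> S \<subseteq> C. x ^ card C * (1 - x) ^ card (weak_nbhd G C)) = x ^ card S"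
proof -
  obtain s where s: "s \<in> S" using assms by (auto simp: connected_sets_iff)
  let ?f = "\<lambda>U. x ^ card U * (1 - x) ^ card (- U)"
  let ?K = "{C. C \<in> connected_sets G \<and> S \<subseteq> C}"
  have "x ^ card S = (\<Sum>U | S \<subseteq> U. ?f U)"
    using sum_between_power_card[of S "{}" x] by simp
  also have "\<dots> = (\<Sum>C\<in>?K. \<Sum>U | U \<in> {U. S \<subseteq> U} \<and> weak_component G s U = C. ?f U)"
  proof (rule sum.group[symmetric])
    have "weak_component G s U \<in> ?K" if "S \<subseteq> U" for U
      using weak_component_connected[of s U G] connected_subset_weak_component[OF assms(2) s that]
        s assms(1) that by auto
    then show "weak_component G s ` {U. S \<subseteq> U} \<subseteq> ?K" by blast
  qed simp_all
  also have "\<dots> = (\<Sum>C\<in>?K. x ^ card C * (1 - x) ^ card (weak_nbhd G C))"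
  proof (rule sum.cong[OF refl])
    fix C assume C: "C \<in> ?K"
    then have "weak_component G s U = C \<longleftrightarrow> C \<subseteq> U \<and> U \<inter> weak_nbhd G C = {}" if "S \<subseteq> U" for U
      using weak_component_eq_iff[of C G s U] s that assms by blast
    \<comment> \<open>Since \<open>S\<close> lies in \<open>C\<close>, the condition that
      \<open>U\<close> contains \<open>S\<close> follows from \<open>U\<close> containing
      \<open>C\<close>.\<close>
    with C have "{U. U \<in> {U. S \<subseteq> U} \<and> weak_component G s U = C} =
        {U. C \<subseteq> U \<and> U \<inter> weak_nbhd G C = {}}" by blast
    moreover have "C \<inter> weak_nbhd G C = {}" by (auto simp: weak_nbhd_def)
    ultimately show "(\<Sum>U | U \<in> {U. S \<subseteq> U} \<and> weak_component G s U = C. ?f U) =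
        x ^ card C * (1 - x) ^ card (weak_nbhd G C)"
      by (simp only: sum_between_power_card)
  qed
  finally show ?thesis ..
qed

section \<open>Walk expansion of the matrix products\<close>

lemma matrix_sub_rdistrib:
  fixes A B :: "'a::ring_1^'n^'m"
  shows "(A - B) ** C = A ** C - B ** C"
  by (simp add: vec_eq_iff matrix_matrix_mult_def left_diff_distrib sum_subtractf)

text \<open>The product is an integer polynomial in the single matrix \<open>z_times A\<close>, in
  which each factor \<open>A\<close> comes with exactly one power of the variable.\<close>

lemma mat_power_z_times_nth:
  fixes A :: "'a::ring_1^'n::finite^'n"
  shows "fps_nth ((mat_power (z_times A) a ** mat_power (mat 1 - z_times A) b) $ i $ j) n =
    of_int (coeff ([:0, 1:] ^ a * (1 - [:0, 1:]) ^ b) n) * mat_power A n $ i $ j"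
proof -
  \<comment> \<open>\<open>R\<close> is the value of the integer polynomial \<open>p\<close> at
    \<open>z_times A\<close>.\<close>
  define represents where "represents R p \<longleftrightarrow>
    (\<forall>i j n. fps_nth (R $ i $ j) n = of_int (coeff p n) * mat_power A n $ i $ j)"
    for R :: "'a fps^'n^'n" and p
  have shift: "represents (z_times A ** R) ([:0, 1:] * p)" if "represents R p" for R p
    unfolding represents_def
  proof (intro allI)
    fix i j n
    have "fps_nth ((z_times A ** R) $ i $ j) n =
        (\<Sum>k\<in>UNIV. if n = 0 then 0 else A $ i $ k * fps_nth (R $ k $ j) (n - 1))"
      by (cases n) (simp_all add: matrix_matrix_mult_def z_times_def fps_sum_nth mult.assoc)
    also have "\<dots> = of_int (coeff ([:0, 1:] * p) n) * mat_power A n $ i $ j"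
    proof (cases n)
      case (Suc m)
      \<comment> \<open>Integers are central even though the labels need not commute.\<close>
      have "A $ i $ k * (of_int c * b) = of_int c * (A $ i $ k * b)" for k c b
        by (metis mult.assoc mult_of_int_commute)
      with Suc that show ?thesis
        by (simp add: represents_def matrix_matrix_mult_def sum_distrib_left)
    qed simp
    finally show "fps_nth ((z_times A ** R) $ i $ j) n =
        of_int (coeff ([:0, 1:] * p) n) * mat_power A n $ i $ j" .
  qed
  have diff: "represents (R - R') (p - q)" if "represents R p" "represents R' q" for R R' p q
    using that by (simp add: represents_def left_diff_distrib)
  let ?x = "[:0, 1:] :: int poly"
  have base: "represents (mat_power (mat 1 - z_times A) b) ((1 - ?x) ^ b)" for b
  proof (induction b)
    case 0
    show ?case
    proof (unfold represents_def, intro allI)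
      fix i j n
      show "fps_nth (mat_power (mat 1 - z_times A) 0 $ i $ j) n =
        of_int (coeff ((1 - ?x) ^ 0) n) * mat_power A n $ i $ j"
        by (cases n) (simp_all add: mat_def)
    qed
  next
    case (Suc b)
    have "mat_power (mat 1 - z_times A) (Suc b) =
        mat_power (mat 1 - z_times A) b - z_times A ** mat_power (mat 1 - z_times A) b"
      by (simp add: matrix_sub_rdistrib)
    moreover have "(1 - ?x) ^ Suc b = (1 - ?x) ^ b - ?x * (1 - ?x) ^ b"
      by (simp only: power_Suc left_diff_distrib mult_1_left)
    ultimately show ?case using diff[OF Suc shift[OF Suc]] by (simp only:)
  qed
  have "represents (mat_power (z_times A) a ** mat_power (mat 1 - z_times A) b) (?x ^ a * (1 - ?x) ^ b)"
  proof (induction a)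
    case 0
    show ?case using base[of b] by (simp only: mat_power.simps matrix_mul_lid power_0 mult_1_left)
  next
    case (Suc a)
    show ?case using shift[OF Suc]
      by (simp only: mat_power.simps matrix_mul_assoc[symmetric] power_Suc mult.assoc)
  qed
  then show ?thesis by (simp only: represents_def)
qed

section \<open>Walks and their vertex sets\<close>

lemmas [simp] = cas_with_proj_eq awalk_verts_with_proj_eq

text \<open>Unlike \<open>awalk_verts\<close>, this needs no start vertex and is empty for the empty
  walk.\<close>

definition arc_verts :: "('n \<times> 'n) list \<Rightarrow> 'n set" where
  "arc_verts p = fst ` set p \<union> snd ` set p"

definition walks :: "'n pair_pre_digraph \<Rightarrow> nat \<Rightarrow> 'n \<Rightarrow> 'n \<Rightarrow> ('n \<times> 'n) list set" where
  "walks G n i j = {p. length p = n \<and> pre_digraph.awalk (with_proj G) i p j}"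

lemma finite_walks: "finite (walks (G :: 'n::finite pair_pre_digraph) n i j)"
  by (rule finite_subset[OF _ finite_lists_length_eq[of UNIV n]]) (auto simp: walks_def)

lemma walks_0: "i \<in> pverts G \<Longrightarrow> walks G 0 i j = (if i = j then {[]} else {})"
  by (auto simp: walks_def pre_digraph.awalk_def)

lemma walks_within_Suc:
  assumes "pverts G = UNIV"
  shows "{p \<in> walks G (Suc n) i j. arc_verts p \<subseteq> C} =
    (\<Union>k\<in>{k. (i, k) \<in> parcs G \<and> i \<in> C \<and> k \<in> C}. (#) (i, k) ` {p \<in> walks G n k j. arc_verts p \<subseteq> C})"
    (is "?L = ?R")
proof (intro set_eqI)
  fix p show "p \<in> ?L \<longleftrightarrow> p \<in> ?R"
    by (cases p) (auto simp: walks_def arc_verts_def pre_digraph.awalk_def assms image_iff)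
qed

lemma mat_power_restrict_nth:
  fixes G :: "'n::finite pair_pre_digraph"
  assumes "pverts G = UNIV"
  shows "mat_power (restrict_mat (labeled_adjacency G \<omega>) C) n $ i $ j =
    (\<Sum>p\<in>{p \<in> walks G n i j. arc_verts p \<subseteq> C}. prod_list (map \<omega> p))"
proof (induction n arbitrary: i)
  case 0
  \<comment> \<open>The empty walk counts even when \<open>i\<close> is outside \<open>C\<close>, in
    agreement with the full identity matrix as zeroth power.\<close>
  have "{p \<in> walks G 0 i j. arc_verts p \<subseteq> C} = (if i = j then {[]} else {})"
    by (auto simp: walks_0 assms arc_verts_def)
  then show ?case by (simp add: mat_def)
next
  case (Suc n)
  let ?W = "\<lambda>k. {p \<in> walks G n k j. arc_verts p \<subseteq> C}"
  let ?K = "{k. (i, k) \<in> parcs G \<and> i \<in> C \<and> k \<in> C}"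
  have "(\<Sum>p\<in>{p \<in> walks G (Suc n) i j. arc_verts p \<subseteq> C}. prod_list (map \<omega> p)) =
      (\<Sum>k\<in>?K. \<Sum>p\<in>(#) (i, k) ` ?W k. prod_list (map \<omega> p))"
    unfolding walks_within_Suc[OF assms]
    by (rule sum.UNION_disjoint) (auto simp: finite_walks)
  also have "\<dots> = (\<Sum>k\<in>?K. \<omega> (i, k) * (\<Sum>p\<in>?W k. prod_list (map \<omega> p)))"
    by (simp add: sum.reindex sum_distrib_left)
  also have "\<dots> = (\<Sum>k\<in>UNIV. if k \<in> ?K then \<omega> (i, k) * (\<Sum>p\<in>?W k. prod_list (map \<omega> p)) else 0)"
    by (simp add: sum.If_cases)
  also have "\<dots> = mat_power (restrict_mat (labeled_adjacency G \<omega>) C) (Suc n) $ i $ j"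
  proof -
    have "restrict_mat (labeled_adjacency G \<omega>) C $ i $ k = (if k \<in> ?K then \<omega> (i, k) else 0)" for k
      by (simp add: restrict_mat_def labeled_adjacency_def)
    then show ?thesis
      by (auto simp: matrix_matrix_mult_def Suc intro!: sum.cong)
  qed
  finally show ?case ..
qed

lemma set_awalk_verts_eq_arc_verts:
  assumes "pre_digraph.awalk (with_proj G) i p j" "p \<noteq> []"
  shows "set (pre_digraph.awalk_verts (with_proj G) i p) = arc_verts p"
proof -
  have "set (pawalk_verts i p) = insert i (arc_verts p)" if "pcas i p j"
    using that by (induction p arbitrary: i) (auto simp: arc_verts_def)
  moreover have "i \<in> arc_verts p" if "pcas i p j"
    using that assms(2) by (cases p) (auto simp: arc_verts_def)
  ultimately show ?thesis using assms(1) by (auto simp: pre_digraph.awalk_def)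
qed

lemma arc_verts_connected:
  assumes "pre_digraph.awalk (with_proj G) i p j" "p \<noteq> []" "pverts G = UNIV"
  shows "arc_verts p \<in> connected_sets G"
proof -
  \<comment> \<open>Induction along the walk: after the first arc, the paths found for the tail
    persist in the larger vertex set.\<close>
  have reach: "(i, v) \<in> (weak_adj G (arc_verts p))\<^sup>*"
    if "pcas i p j" "set p \<subseteq> parcs G" "v \<in> arc_verts p" for v
    using that
  proof (induction p arbitrary: i)
    case (Cons e q)
    let ?A = "(weak_adj G (arc_verts (e # q)))\<^sup>*"
    have e: "e = (i, snd e)" "pcas (snd e) q j" using Cons.prems by (auto simp: prod_eq_iff)
    have 1: "(i, snd e) \<in> ?A"
      using e(1) Cons.prems by (intro r_into_rtrancl) (auto simp: weak_adj_def arc_verts_def prod_eq_iff)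
    have "(snd e, v) \<in> ?A" if "v \<in> arc_verts q"
      using Cons.IH[OF e(2) _ that] Cons.prems(2)
        rtrancl_mono[OF weak_adj_mono[of "arc_verts q" "arc_verts (e # q)" G]]
      by (auto simp: arc_verts_def)
    with 1 have "(i, v) \<in> ?A" if "v \<in> arc_verts q" using that by (meson rtrancl_trans)
    moreover have "v = i \<or> v = snd e \<or> v \<in> arc_verts q"
      using Cons.prems(3) e(1) by (auto simp: arc_verts_def) (metis fst_conv)
    ultimately show ?case using 1 by auto
  qed (simp add: arc_verts_def)
  have "i \<in> arc_verts p"
    using assms(1,2) by (cases p) (auto simp: arc_verts_def pre_digraph.awalk_def)
  then show ?thesis
    using reach assms by (intro connected_setsI[of i]) (auto simp: pre_digraph.awalk_def)
qed

text \<open>In a closed walk each head is the tail of the next arc or of the first one, so the tails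
  alone cover all vertices.\<close>

lemma card_arc_verts_closed_le:
  assumes "pre_digraph.awalk (with_proj G) i p i"
  shows "card (arc_verts p) \<le> length p"
proof -
  \<comment> \<open>The end is decoupled from the start because the tail of a closed walk is in
    general not closed.\<close>
  have "snd ` set p \<subseteq> insert j (fst ` set p)" if "pcas i p j" for j
    using that
  proof (induction p arbitrary: i)
    case (Cons e q)
    then have "pcas (snd e) q j" by simp
    then have "snd e \<in> insert j (fst ` set q)" by (cases q) auto
    with Cons show ?case by auto
  qed simp
  moreover have "i \<in> fst ` set p" if "pcas i p i" "p \<noteq> []"
    using that by (cases p) auto
  ultimately have "arc_verts p = fst ` set p"
    using assms by (cases "p = []") (auto simp: arc_verts_def pre_digraph.awalk_def)
  then show ?thesis by (metis card_image_le card_length finite_set le_trans)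
qed

text \<open>Double counting of the pairs of a connected set and a walk inside it. The weight
  \<open>f\<close> is arbitrary so that both exponents, \<open>card C - 1\<close> and
  \<open>card C\<close>, are covered.\<close>

lemma sum_connected_mat_power_nth:
  fixes G :: "'n::finite pair_pre_digraph" and \<omega> :: "'n \<times> 'n \<Rightarrow> 'a::ring_1"
  assumes "pverts G = UNIV"
  shows "(\<Sum>C\<in>connected_sets G. of_int (f C) * mat_power (restrict_mat (labeled_adjacency G \<omega>) C) n $ i $ j) =
    (\<Sum>p\<in>walks G n i j. of_int (\<Sum>C | C \<in> connected_sets G \<and> arc_verts p \<subseteq> C. f C) * prod_list (map \<omega> p))"
proof -
  let ?w = "\<lambda>p. prod_list (map \<omega> p)"
  have "(\<Sum>C\<in>connected_sets G. of_int (f C) * mat_power (restrict_mat (labeled_adjacency G \<omega>) C) n $ i $ j) =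
      (\<Sum>C\<in>connected_sets G. \<Sum>p | p \<in> walks G n i j \<and> arc_verts p \<subseteq> C. of_int (f C) * ?w p)"
    by (simp add: mat_power_restrict_nth assms sum_distrib_left)
  also have "\<dots> = (\<Sum>p\<in>walks G n i j. \<Sum>C | C \<in> connected_sets G \<and> arc_verts p \<subseteq> C. of_int (f C) * ?w p)"
    by (rule sum.swap_restrict) (simp_all add: finite_walks)
  finally show ?thesis by (simp add: sum_distrib_right)
qed

lemma sum_connected_supersets_coeff:
  fixes G :: "'n::finite pair_pre_digraph"
  assumes "pverts G = UNIV" "S \<in> connected_sets G"
  shows "(\<Sum>C | C \<in> connected_sets G \<and> S \<subseteq> C.
      coeff ([:0, 1:] ^ card C * (1 - [:0, 1:] :: int poly) ^ card (weak_nbhd G C)) n) =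
    (if n = card S then 1 else 0)"
proof -
  have "[:0, 1:] ^ card S = monom (1::int) (card S)" by (simp add: monom_altdef)
  then show ?thesis
    unfolding coeff_sum[symmetric] sum_connected_supersets[OF assms] by (auto simp: coeff_monom)
qed

section \<open>Simple paths\<close>

lemma P_mat_nth:
  "fps_nth (P_mat G \<omega> $ i $ j) n =
    (\<Sum>p | p \<in> simple_paths G i j \<and> length p = n. prod_list (map \<omega> p))"
proof -
  have "fps_nth (P_mat G \<omega> $ i $ j) n =
      (\<Sum>p\<in>simple_paths G i j. if length p = n then prod_list (map \<omega> p) else 0)"
    by (auto simp: P_mat_def fps_sum_nth fps_X_power_nth intro!: sum.cong)
  then show ?thesis by (simp add: sum.If_cases finite_simple_paths Int_def)
qed

lemma open_simple_paths_eq_walks: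
  assumes "i \<noteq> j"
  shows "{p. p \<in> simple_paths G i j \<and> length p = n} = {p \<in> walks G n i j. Suc n = card (arc_verts p)}"
proof -
  have "p \<noteq> []" if "pre_digraph.awalk (with_proj G) i p j" for p
    using that assms by (auto simp: pre_digraph.awalk_def)
  \<comment> \<open>This makes the truncated \<open>card V - 1\<close> of
    \<open>simple_paths\<close> equivalent to the condition with \<open>Suc n\<close>.\<close>
  moreover have "card (arc_verts p) \<noteq> 0" if "p \<noteq> []" for p :: "('a \<times> 'a) list"
    using that by (auto simp: arc_verts_def)
  ultimately show ?thesis
    using assms set_awalk_verts_eq_arc_verts[of G i _ j]
    by (fastforce simp: simple_paths_def walks_def Let_def)
qed

text \<open>Length 0 is excluded because the empty walk has 0 arcs and empty
  \<open>arc_verts\<close>, yet is not a simple path.\<close>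

lemma closed_simple_paths_eq_walks:
  assumes "n > 0"
  shows "{p. p \<in> simple_paths G i i \<and> length p = n} = {p \<in> walks G n i i. n = card (arc_verts p)}"
proof (intro set_eqI iffI; elim CollectE conjE)
  fix p assume "p \<in> simple_paths G i i" "length p = n"
  then show "p \<in> {p \<in> walks G n i i. n = card (arc_verts p)}"
    using set_awalk_verts_eq_arc_verts[of G i p i] by (simp add: simple_paths_def walks_def Let_def)
next
  fix p assume "p \<in> walks G n i i" "n = card (arc_verts p)"
  with assms show "p \<in> {p. p \<in> simple_paths G i i \<and> length p = n}"
    using set_awalk_verts_eq_arc_verts[of G i p i]
    by (cases "p = []") (simp_all add: simple_paths_def walks_def Let_def)
qed

text \<open>The formula also covers the diagonal: a closed walk of length \<open>n\<close> has at
  most \<open>n\<close> vertices, so all its terms vanish there.\<close>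

lemma P_op_nth:
  assumes "pverts G = UNIV" "n > 0"
  shows "fps_nth (P_op G \<omega> $ i $ j) n =
    (\<Sum>p\<in>walks G n i j. if Suc n = card (arc_verts p) then prod_list (map \<omega> p) else 0)"
proof (cases "i = j")
  case True
  then have "Suc n \<noteq> card (arc_verts p)" if "p \<in> walks G n i j" for p
    using that card_arc_verts_closed_le[of G i p] by (auto simp: walks_def)
  with True show ?thesis by (simp add: P_op_def P_cl_def Diag_def)
next
  case False
  then have "fps_nth (P_op G \<omega> $ i $ j) n = fps_nth (P_mat G \<omega> $ i $ j) n"
    by (simp add: P_op_def P_cl_def Diag_def)
  also have "\<dots> = (\<Sum>p\<in>walks G n i j. if Suc n = card (arc_verts p) then prod_list (map \<omega> p) else 0)"
    unfolding P_mat_nth open_simple_paths_eq_walks[OF False]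
    by (simp add: sum.inter_filter finite_walks)
  finally show ?thesis .
qed

lemma P_mat_nth_0: "fps_nth (P_mat G \<omega> $ i $ j) 0 = 0"
  unfolding P_mat_nth by (rule sum.neutral) (auto simp: simple_paths_def)

section \<open>Comparison of coefficients\<close>

lemma mat_power_zW_nth:
  fixes G :: "'n::finite pair_pre_digraph" and \<omega> :: "'n \<times> 'n \<Rightarrow> 'a::ring_1"
  shows "fps_nth ((mat_power (zW G \<omega> C) a ** mat_power (mat 1 - zW G \<omega> C) b) $ i $ j) n =
    of_int (coeff ([:0, 1:] ^ a * (1 - [:0, 1:]) ^ b) n) *
      mat_power (restrict_mat (labeled_adjacency G \<omega>) C) n $ i $ j"
  by (simp only: zW_def mat_power_z_times_nth)

text \<open>Moves the exponent \<open>card C - 1\<close> to \<open>card C\<close>, where the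
  component identity applies, at the price of reading off coefficient \<open>Suc n\<close>.\<close>

lemma coeff_pCons_power_Suc:
  assumes "m > 0"
  shows "coeff ([:0, 1:] ^ (m - 1) * q) n = coeff ([:0, 1:] ^ m * q) (Suc n)"
  using assms by (cases m) (simp_all add: mult.assoc)

text \<open>Only singletons have exponent 0 and hence a constant term, which is 1. Their number is
  the multiple of the identity subtracted in \<open>P_op_eq\<close>.\<close>

lemma sum_connected_nth_0:
  fixes G :: "'n::finite pair_pre_digraph"
  assumes "pverts G = UNIV"
  shows "(\<Sum>C\<in>connected_sets G.
      coeff ([:0, 1:] ^ (card C - 1) * (1 - [:0, 1:] :: int poly) ^ card (weak_nbhd G C)) 0) = int CARD('n)"
proof -
  have "coeff ([:0, 1:] ^ (card C - 1) * (1 - [:0, 1:] :: int poly) ^ card (weak_nbhd G C)) 0 =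
      (if card C = 1 then 1 else 0)" if "C \<in> connected_sets G" for C
  proof -
    have "card C > 0" using that by (simp add: connected_sets_iff card_gt_0_iff)
    \<comment> \<open>The constant coefficient is the value at 0, where the second factor is
      1.\<close>
    then show ?thesis by (auto simp: poly_0_coeff_0[symmetric] zero_power)
  qed
  then have "(\<Sum>C\<in>connected_sets G.
      coeff ([:0, 1:] ^ (card C - 1) * (1 - [:0, 1:] :: int poly) ^ card (weak_nbhd G C)) 0) =
      int (card {C \<in> connected_sets G. card C = 1})"
    by (simp add: sum.If_cases Int_def)
  also have "{C \<in> connected_sets G. card C = 1} = range (\<lambda>v. {v})"
    using singleton_connected[of _ G] by (auto simp: assms card_1_singleton_iff)
  also have "card \<dots> = CARD('n)" by (simp add: card_image)
  finally show ?thesis .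
qed

lemma P_op_eq:
  fixes G :: "'n::finite pair_pre_digraph" and \<omega> :: "'n \<times> 'n \<Rightarrow> 'a::ring_1"
  assumes "pverts G = UNIV"
  shows "P_op G \<omega> =
      (\<Sum>C\<in>connected_sets G.
         mat_power (zW G \<omega> C) (card C - 1) ** mat_power (mat 1 - zW G \<omega> C) (card (weak_nbhd G C)))
      - mat (of_nat CARD('n))" (is "_ = ?S - _")
proof -
  have "fps_nth (P_op G \<omega> $ i $ j) n = fps_nth ((?S - mat (of_nat CARD('n))) $ i $ j) n" for i j n
  proof -
    define c where "c C = coeff ([:0, 1:] ^ (card C - 1) * (1 - [:0, 1:] :: int poly) ^ card (weak_nbhd G C)) n" for C
    have S: "fps_nth (?S $ i $ j) n =
        (\<Sum>C\<in>connected_sets G. of_int (c C) * mat_power (restrict_mat (labeled_adjacency G \<omega>) C) n $ i $ j)"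
      by (simp only: sum_component fps_sum_nth mat_power_zW_nth c_def)
    show ?thesis
    proof (cases "n = 0")
      \<comment> \<open>The empty walk has no vertices, so the component identity does not apply to
        it; the constant terms are summed directly.\<close>
      case True
      then have "fps_nth (?S $ i $ j) n = of_int (\<Sum>C\<in>connected_sets G. c C) * mat 1 $ i $ j"
        unfolding S by (simp only: mat_power.simps of_int_sum sum_distrib_right)
      also have "\<dots> = of_nat CARD('n) * mat 1 $ i $ j"
        unfolding c_def True sum_connected_nth_0[OF assms] by simp
      finally show ?thesis
        using True by (simp add: P_op_def P_cl_def Diag_def P_mat_nth_0 mat_def fps_of_nat[symmetric])
    next
      case False
      then have n: "n > 0" by simp
      \<comment> \<open>The total coefficient of one walk: it survives exactly when its
        \<open>n\<close> arcs meet \<open>n + 1\<close> vertices.\<close>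
      have coeffs: "(\<Sum>C | C \<in> connected_sets G \<and> arc_verts p \<subseteq> C. c C) = (if Suc n = card (arc_verts p) then 1 else 0)"
        if "p \<in> walks G n i j" for p
      proof -
        have p: "arc_verts p \<in> connected_sets G"
          using that False assms by (intro arc_verts_connected[of G i p j]) (auto simp: walks_def)
        have "c C = coeff ([:0, 1:] ^ card C * (1 - [:0, 1:]) ^ card (weak_nbhd G C)) (Suc n)"
          if "C \<in> connected_sets G" for C
          using that unfolding c_def by (intro coeff_pCons_power_Suc) (simp add: connected_sets_iff card_gt_0_iff)
        then show ?thesis
          using sum_connected_supersets_coeff[OF assms p, of "Suc n"] by simp
      qed
      have "fps_nth (?S $ i $ j) n = fps_nth (P_op G \<omega> $ i $ j) n"
        unfolding S sum_connected_mat_power_nth[OF assms] P_op_nth[OF assms n]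
        by (rule sum.cong) (simp_all del: of_int_sum add: coeffs)
      moreover have "fps_nth (mat (of_nat CARD('n)) $ i $ j :: 'a fps) n = 0"
        using False by (simp add: mat_def fps_of_nat[symmetric])
      ultimately show ?thesis by simp
    qed
  qed
  then show ?thesis by (simp add: vec_eq_iff fps_eq_iff)
qed

lemma P_cl_eq:
  fixes G :: "'n::finite pair_pre_digraph" and \<omega> :: "'n \<times> 'n \<Rightarrow> 'a::ring_1"
  assumes "pverts G = UNIV"
  shows "P_cl G \<omega> =
      (\<Sum>C\<in>connected_sets G.
         Diag (mat_power (zW G \<omega> C) (card C) ** mat_power (mat 1 - zW G \<omega> C) (card (weak_nbhd G C))))"
    (is "_ = (\<Sum>C\<in>_. Diag (?M C))")
proof -
  have "fps_nth (P_mat G \<omega> $ i $ i) n = (\<Sum>C\<in>connected_sets G. fps_nth (?M C $ i $ i) n)" for i n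
  proof (cases "n = 0")
    case True
    have "fps_nth (?M C $ i $ i) 0 = 0" if "C \<in> connected_sets G" for C
    proof -
      have "card C > 0" using that by (simp add: connected_sets_iff card_gt_0_iff)
      then show ?thesis
        unfolding mat_power_zW_nth by (simp add: poly_0_coeff_0[symmetric] zero_power)
    qed
    with True show ?thesis by (simp add: P_mat_nth_0)
  next
    case False
    have coeffs: "(\<Sum>C | C \<in> connected_sets G \<and> arc_verts p \<subseteq> C.
        coeff ([:0, 1:] ^ card C * (1 - [:0, 1:] :: int poly) ^ card (weak_nbhd G C)) n) =
        (if n = card (arc_verts p) then 1 else 0)" if "p \<in> walks G n i i" for p
      using that False assms
      by (intro sum_connected_supersets_coeff arc_verts_connected[of G i p i]) (auto simp: walks_def)
    have "fps_nth (P_mat G \<omega> $ i $ i) n =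
        (\<Sum>p\<in>walks G n i i. if n = card (arc_verts p) then prod_list (map \<omega> p) else 0)"
      using False by (simp add: P_mat_nth closed_simple_paths_eq_walks sum.inter_filter finite_walks)
    also have "\<dots> = (\<Sum>C\<in>connected_sets G. fps_nth (?M C $ i $ i) n)"
      unfolding mat_power_zW_nth sum_connected_mat_power_nth[OF assms]
      by (rule sum.cong) (simp_all del: of_int_sum add: coeffs)
    finally show ?thesis .
  qed
  then show ?thesis
    by (simp add: P_cl_def Diag_def vec_eq_iff fps_eq_iff fps_sum_nth)
qed

theorem theorem1:
  fixes G :: "'n::finite pair_pre_digraph"
    and \<omega> :: "'n \<times> 'n \<Rightarrow> 'a::ring_1"
  assumes "pverts G = UNIV"
  shows "P_op G \<omega> =
      (\<Sum>C\<in>connected_sets G.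
         mat_power (zW G \<omega> C) (card C - 1) ** mat_power (mat 1 - zW G \<omega> C) (card (weak_nbhd G C)))
      - mat (of_nat CARD('n))
      \<and> P_cl G \<omega> =
      (\<Sum>C\<in>connected_sets G.
         Diag (mat_power (zW G \<omega> C) (card C) ** mat_power (mat 1 - zW G \<omega> C) (card (weak_nbhd G C))))"
  using P_op_eq P_cl_eq assms by blast

end
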